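(* Let $X$ be a metric space, let $Y$ be a closed convex subset of $\mathbb{R}^d$, and let $f:X\to Y$ be a usco-bounded Baire-one function. Then there is a usco-bounded sequence of continuous functions $f_n:X\to Y$, $n\in\mathbb{N}$, which converges pointwise to $f$ on $X$.
   Context: Let $X$ and $Y$ be metric spaces. A set-valued mapping $\varphi:X\to Y$ (assigning to each $x\in X$ a subset $\varphi(x)\subset Y$) is called usco (upper semi-continuous compact valued) if $\varphi(x)$ is a nonempty compact subset of $Y$ for each $x\in X$ and $\{x\in X:\varphi(x)\subset U\}$ is open in $X$ for each open $U\subset Y$. Its graph is $\{(x,y)\in X\times Y: y\in\varphi(x)\}$. A family of functions from $X$ to $Y$ is called usco-bounded if there is a single usco map $\varphi:X\to Y$ whose graph contains the graphs of all functions in the family; a single function $f$ is usco-bounded if the family $\{f\}$ is, and a sequence is usco-bounded if the family of its members is. A function $f:X\to Y$ is Baire-one if it is the pointwise limit of a sequence of continuous functions $X\to Y$. *)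

theory Defs
  imports "HOL-Analysis.Analysis"
begin

text \<open>
  The metric spaces X and Y are represented by carrier sets inside types of class
  \<open>metric_space\<close>, with the restricted metrics; taking the carrier \<open>UNIV\<close> gives a whole type.
  Openness is relative to the carriers, and nothing is required of the values of a mapping
  outside its domain X.
\<close>

definition usco :: "'a::metric_space set \<Rightarrow> 'b::metric_space set \<Rightarrow> ('a \<Rightarrow> 'b set) \<Rightarrow> bool" where
  "usco X Y \<phi> \<longleftrightarrow>
     (\<forall>x\<in>X. \<phi> x \<subseteq> Y \<and> \<phi> x \<noteq> {} \<and> compact (\<phi> x)) \<and>
     (\<forall>U. openin (top_of_set Y) U \<longrightarrow> openin (top_of_set X) {x \<in> X. \<phi> x \<subseteq> U})"

text \<open>\<open>Sigma X \<phi>\<close> is the graph of the set-valued mapping \<open>\<phi>\<close> on X.\<close>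

definition usco_bounded ::
    "'a::metric_space set \<Rightarrow> 'b::metric_space set \<Rightarrow> ('a \<Rightarrow> 'b) set \<Rightarrow> bool" where
  "usco_bounded X Y F \<longleftrightarrow>
     (\<exists>\<phi>. usco X Y \<phi> \<and> (\<forall>f\<in>F. (\<lambda>x. (x, f x)) ` X \<subseteq> Sigma X \<phi>))"

definition baire_one ::
    "'a::metric_space set \<Rightarrow> 'b::metric_space set \<Rightarrow> ('a \<Rightarrow> 'b) \<Rightarrow> bool" where
  "baire_one X Y f \<longleftrightarrow>
     f \<in> X \<rightarrow> Y \<and>
     (\<exists>h :: nat \<Rightarrow> 'a \<Rightarrow> 'b.
        (\<forall>n. h n \<in> X \<rightarrow> Y \<and> continuous_on X (h n)) \<and>
        (\<forall>x\<in>X. (\<lambda>n. h n x) \<longlonglongrightarrow> f x))"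

end

theory Submission
  imports Defs
begin

text \<open>
  A usco-bounded map into a Euclidean space is locally bounded, and a locally bounded function
  \<open>u \<ge> 1\<close> on a metric space is dominated by the continuous function \<open>1 / \<delta>\<close>, where
  \<open>\<delta> x = inf\<^sub>z (dist x z + 1 / u z)\<close> is positive, 1-Lipschitz and at most \<open>1 / u x\<close>. Fixing a point
  \<open>c\<close> of \<open>Y\<close> and such a continuous bound \<open>R\<close> for the distance of \<open>f\<close> from \<open>c\<close>, we pull the
  continuous approximations \<open>h n x\<close> radially towards \<open>c\<close> into the ball of radius \<open>R x\<close>. By
  convexity they stay in \<open>Y\<close>, the limit is unaffected, and \<open>x \<mapsto> Y \<inter> cball c (R x)\<close> is usco.
\<close>

lemma continuous_majorant:
  fixes X :: "'a::metric_space set" and u :: "'a \<Rightarrow> real"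
  assumes loc: "\<And>x. x \<in> X \<Longrightarrow> \<exists>r>0. \<exists>M. \<forall>z\<in>X. dist x z < r \<longrightarrow> u z \<le> M"
    and ge1: "\<And>x. x \<in> X \<Longrightarrow> 1 \<le> u x"
  obtains R where "continuous_on X R" "\<And>x. x \<in> X \<Longrightarrow> u x \<le> R x"
proof -
  define \<delta> where "\<delta> x = (INF z\<in>X. dist x z + 1 / u z)" for x
  have bdd: "bdd_below ((\<lambda>z. dist x z + 1 / u z) ` X)" for x
    by (rule bdd_belowI2[of _ 0]) (use ge1 in \<open>fastforce intro!: add_nonneg_nonneg\<close>)
  have lower: "\<delta> x \<le> dist x z + 1 / u z" if "z \<in> X" for x z
    unfolding \<delta>_def using bdd that by (rule cINF_lower)
  have pos: "0 < \<delta> x" if x: "x \<in> X" for x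
  proof -
    obtain r M where r: "r > 0" and M: "\<And>z. z \<in> X \<Longrightarrow> dist x z < r \<Longrightarrow> u z \<le> M"
      using loc[OF x] by blast
    have "M \<ge> 1"
      using M[OF x] ge1[OF x] r by simp
    \<comment> \<open>Points within \<open>r\<close> of \<open>x\<close> contribute at least
      \<open>1 / M\<close> to the infimum through the second summand, all others at least
      \<open>r\<close> through the first.\<close>
    have "min r (1 / M) \<le> \<delta> x"
      unfolding \<delta>_def
    proof (rule cINF_greatest)
      fix z assume z: "z \<in> X"
      show "min r (1 / M) \<le> dist x z + 1 / u z"
      proof (cases "dist x z < r")
        case True
        then have "1 / M \<le> 1 / u z"
          using M[OF z] ge1[OF z] by (intro divide_left_mono) auto
        then show ?thesis
          using zero_le_dist[of x z] by linarith
      next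
        case False
        then show ?thesis
          using ge1[OF z] by (simp add: min_le_iff_disj add_increasing2)
      qed
    qed (use x in auto)
    then show ?thesis
      using r \<open>M \<ge> 1\<close> by (smt (verit) zero_less_divide_1_iff)
  qed
  \<comment> \<open>One half of the 1-Lipschitz estimate, inherited from the distances under the
    infimum; exchanging \<open>x\<close> and \<open>y\<close> gives the other half.\<close>
  have half: "\<delta> x \<le> \<delta> y + dist x y" if "y \<in> X" for x y
  proof -
    have "\<delta> x - dist x y \<le> \<delta> y"
      unfolding \<delta>_def[of y]
    proof (rule cINF_greatest)
      fix z assume "z \<in> X"
      then show "\<delta> x - dist x y \<le> dist y z + 1 / u z"
        using lower[of z x] dist_triangle[of x z y] by linarith
    qed (use that in auto)
    then show ?thesis by simp
  qed
  have "continuous_on X \<delta>"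
    unfolding continuous_on_iff
  proof (intro ballI allI impI)
    fix x and e :: real assume x: "x \<in> X" and e: "e > 0"
    have "dist (\<delta> y) (\<delta> x) < e" if "y \<in> X" "dist y x < e" for y
      using half[OF x, of y] half[OF that(1), of x] that(2)
      by (simp add: dist_real_def dist_commute abs_less_iff)
    with e show "\<exists>d>0. \<forall>y\<in>X. dist y x < d \<longrightarrow> dist (\<delta> y) (\<delta> x) < e"
      by blast
  qed
  moreover have "\<delta> x \<noteq> 0" if "x \<in> X" for x
    using pos[OF that] by simp
  ultimately have "continuous_on X (\<lambda>x. 1 / \<delta> x)"
    by (intro continuous_intros) auto
  moreover have "u x \<le> 1 / \<delta> x" if x: "x \<in> X" for x
    using lower[OF x, of x] pos[OF x] ge1[OF x] by (simp add: field_simps)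
  ultimately show ?thesis
    by (rule that)
qed

text \<open>The compact value at \<open>x\<close> fits into an open ball around \<open>c\<close>,
  and upper semi-continuity keeps the values at all nearby points inside that ball.\<close>

lemma usco_bounded_locally_bounded:
  fixes f :: "'a::metric_space \<Rightarrow> 'b::metric_space"
  assumes "usco_bounded X Y {f}" and x: "x \<in> X"
  shows "\<exists>r>0. \<exists>M. \<forall>z\<in>X. dist x z < r \<longrightarrow> dist c (f z) \<le> M"
proof -
  obtain \<phi> where u: "usco X Y \<phi>" and f: "\<And>z. z \<in> X \<Longrightarrow> f z \<in> \<phi> z"
    using assms(1) unfolding usco_bounded_def by auto
  have "bounded (\<phi> x)"
    using u x by (simp add: usco_def compact_imp_bounded)
  then obtain M where "\<phi> x \<subseteq> ball c M"
    using bounded_subset_ballD by blast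
  define V where "V = {z \<in> X. \<phi> z \<subseteq> Y \<inter> ball c M}"
  have "openin (top_of_set X) V"
    using u openin_open_Int[OF open_ball, of Y c M] unfolding usco_def V_def by blast
  moreover have "x \<in> V"
    using u x \<open>\<phi> x \<subseteq> ball c M\<close> unfolding usco_def V_def by auto
  ultimately obtain r where "r > 0" and r: "\<And>z. z \<in> X \<Longrightarrow> dist z x < r \<Longrightarrow> z \<in> V"
    unfolding openin_euclidean_subtopology_iff by blast
  have "dist c (f z) \<le> M" if "z \<in> X" "dist x z < r" for z
    using r[of z] f[of z] that unfolding V_def by (fastforce simp: dist_commute)
  with \<open>r > 0\<close> show ?thesis by blast
qed

text \<open>The value at \<open>x\<close> fails to lie in \<open>U\<close> exactly when the ball
  reaches the closed set \<open>Y - U\<close>. Only the radius varies, so the points with value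
  inside \<open>U\<close> form the preimage under \<open>R\<close> of an open half-line.\<close>

lemma usco_Int_cball:
  fixes Y :: "'b::heine_borel set" and R :: "'a::metric_space \<Rightarrow> real"
  assumes "closed Y" "c \<in> Y" "continuous_on X R" "\<And>x. x \<in> X \<Longrightarrow> 0 \<le> R x"
  shows "usco X Y (\<lambda>x. Y \<inter> cball c (R x))"
  unfolding usco_def
proof (intro conjI ballI allI impI)
  fix U assume U: "openin (top_of_set Y) U"
  define C where "C = Y - U"
  have "closed C"
    unfolding C_def using U assms(1) by (meson closedin_closed_trans closedin_diff closedin_subtopology_refl closedin_self)
  show "openin (top_of_set X) {x \<in> X. Y \<inter> cball c (R x) \<subseteq> U}"
  \<comment> \<open>The empty set needs its own case: \<open>infdist c {}\<close> is 0 by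
    convention, although the inclusion then holds for every radius.\<close>
  proof (cases "C = {}")
    case True
    then have "{x \<in> X. Y \<inter> cball c (R x) \<subseteq> U} = X"
      unfolding C_def by auto
    then show ?thesis by simp
  next
    case False
    have "Y \<inter> cball c r \<subseteq> U \<longleftrightarrow> r < infdist c C" for r
    proof
      assume sub: "Y \<inter> cball c r \<subseteq> U"
      \<comment> \<open>A nearest point of \<open>C\<close> lies outside \<open>U\<close>, hence
        outside the ball; that the distance is attained makes the inequality strict.\<close>
      obtain y where "y \<in> C" "infdist c C = dist c y"
        using infdist_attains_inf[OF \<open>closed C\<close> False] by blast
      with sub show "r < infdist c C"
        unfolding C_def by fastforce
    next
      assume r: "r < infdist c C"
      show "Y \<inter> cball c r \<subseteq> U"
      proof
        fix y assume y: "y \<in> Y \<inter> cball c r"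
        show "y \<in> U"
          using infdist_le[of y C c] y r unfolding C_def by fastforce
      qed
    qed
    then have "{x \<in> X. Y \<inter> cball c (R x) \<subseteq> U} = X \<inter> R -` {..<infdist c C}"
      by auto
    then show ?thesis
      using continuous_openin_preimage_gen[OF assms(3) open_lessThan] by simp
  qed
qed (use assms in \<open>auto simp: closed_Int_compact\<close>)

text \<open>For \<open>r > 0\<close> this is the radial retraction onto \<open>cball c r\<close>.
  Writing the factor with \<open>max\<close> avoids a case split and makes continuity in
  \<open>r\<close> and \<open>y\<close> together immediate.\<close>

definition radial :: "'b::real_normed_vector \<Rightarrow> real \<Rightarrow> 'b \<Rightarrow> 'b" where
  "radial c r y = c + (r / max r (dist c y)) *\<^sub>R (y - c)"

text \<open>The scaling factor lies between 0 and 1, so the image is on the segment from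
  \<open>c\<close> to \<open>y\<close>.\<close>

lemma radial_in_convex:
  assumes "convex Y" "c \<in> Y" "y \<in> Y" "0 < r"
  shows "radial c r y \<in> Y"
proof -
  have "(1 - t) *\<^sub>R c + t *\<^sub>R y \<in> Y" if "0 \<le> t" "t \<le> 1" for t
    using assms(1-3) that by (auto intro: convexD_alt)
  from this[of "r / max r (dist c y)"] show ?thesis
    using assms(4) by (simp add: radial_def algebra_simps)
qed

lemma radial_in_cball:
  assumes "0 < r"
  shows "radial c r y \<in> cball c r"
proof -
  have "r * dist c y \<le> r * max r (dist c y)"
    using assms by (intro mult_left_mono) auto
  then show ?thesis
    using assms by (simp add: radial_def dist_norm norm_minus_commute divide_le_eq less_max_iff_disj)
qed

lemma radial_eq:
  assumes "0 < r" "dist c y \<le> r"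
  shows "radial c r y = y"
  using assms by (simp add: radial_def max_absorb1)

lemma usco_bounded_approximation:
  fixes X :: "'a::metric_space set" and Y :: "'b::euclidean_space set"
  assumes "closed Y" "convex Y" "c \<in> Y" "usco_bounded X Y {f}" "baire_one X Y f"
  shows "\<exists>g :: nat \<Rightarrow> 'a \<Rightarrow> 'b.
           (\<forall>n. g n \<in> X \<rightarrow> Y \<and> continuous_on X (g n)) \<and>
           usco_bounded X Y (range g) \<and>
           (\<forall>x\<in>X. (\<lambda>n. g n x) \<longlonglongrightarrow> f x)"
proof -
  \<comment> \<open>The maximum with 1 supplies the lower bound demanded by
    \<open>continuous_majorant\<close> and makes the radius \<open>R\<close> positive.\<close>
  have "\<exists>r>0. \<exists>M. \<forall>z\<in>X. dist x z < r \<longrightarrow> max 1 (dist c (f z)) \<le> M" if "x \<in> X" for x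
    using usco_bounded_locally_bounded[OF assms(4) that, of c] by (meson max.mono order_refl)
  then obtain R where R: "continuous_on X R" "\<And>x. x \<in> X \<Longrightarrow> max 1 (dist c (f x)) \<le> R x"
    using continuous_majorant[of X "\<lambda>x. max 1 (dist c (f x))"] by auto
  have Rpos: "0 < R x" if "x \<in> X" for x
    using R(2)[OF that] by simp
  obtain h where hY: "\<And>n. h n \<in> X \<rightarrow> Y" and hc: "\<And>n. continuous_on X (h n)"
    and hl: "\<And>x. x \<in> X \<Longrightarrow> (\<lambda>n. h n x) \<longlonglongrightarrow> f x"
    using assms(5) unfolding baire_one_def by blast
  define g where "g n x = radial c (R x) (h n x)" for n x
  have gY: "g n x \<in> Y" if "x \<in> X" for n x
    unfolding g_def using hY[of n] that Rpos assms by (intro radial_in_convex) auto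
  moreover have "continuous_on X (g n)" for n
    unfolding g_def radial_def
    by (intro continuous_intros R hc) (use Rpos in \<open>auto simp: max_def simp flip: not_less\<close>)
  moreover have "usco_bounded X Y (range g)"
  proof -
    have "usco X Y (\<lambda>x. Y \<inter> cball c (R x))"
      using assms R(1) Rpos by (intro usco_Int_cball) (auto intro: less_imp_le)
    moreover have "g n x \<in> cball c (R x)" if "x \<in> X" for n x
      unfolding g_def by (rule radial_in_cball[OF Rpos[OF that]])
    ultimately show ?thesis
      using gY unfolding usco_bounded_def by (intro exI[of _ "\<lambda>x. Y \<inter> cball c (R x)"]) auto
  qed
  moreover have "(\<lambda>n. g n x) \<longlonglongrightarrow> f x" if x: "x \<in> X" for x
  proof -
    have "(\<lambda>n. g n x) \<longlonglongrightarrow> radial c (R x) (f x)"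
      unfolding g_def radial_def using Rpos[OF x]
      by (intro tendsto_intros hl x) (auto simp: max_def)
    \<comment> \<open>\<open>R x\<close> dominates the distance of \<open>f x\<close> from
      \<open>c\<close>, so the retraction fixes the limit \<open>f x\<close>.\<close>
    then show ?thesis
      using radial_eq[of "R x" c "f x"] R(2)[OF x] Rpos[OF x] by simp
  qed
  ultimately show ?thesis
    by (intro exI[of _ g]) auto
qed

theorem theorem3p3:
  fixes X :: "'a::metric_space set"
    and Y :: "(real ^ 'd) set"
    and f :: "'a \<Rightarrow> real ^ 'd"
  assumes "closed Y" and "convex Y"
    and "f \<in> X \<rightarrow> Y"
    and "usco_bounded X Y {f}"
    and "baire_one X Y f"
  shows "\<exists>g :: nat \<Rightarrow> 'a \<Rightarrow> real ^ 'd.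
           (\<forall>n. g n \<in> X \<rightarrow> Y \<and> continuous_on X (g n)) \<and>
           usco_bounded X Y (range g) \<and>
           (\<forall>x\<in>X. (\<lambda>n. g n x) \<longlonglongrightarrow> f x)"
proof (cases "X = {}")
  \<comment> \<open>Here \<open>Y\<close> may be empty and offer no centre \<open>c\<close>, but
    every requirement holds trivially.\<close>
  case True
  then show ?thesis
    by (auto simp: usco_bounded_def usco_def)
next
  case False
  then obtain c where "c \<in> Y"
    using assms(3) by auto
  from usco_bounded_approximation[OF assms(1,2) this assms(4,5)] show ?thesis .
qed

end
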